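(* In the noisy model with parameter $\gamma$, any (possibly randomized) algorithm obtaining an $(n^{3/8}/40)$-approximation for RANK on inputs of size $n$ with probability $2/3$ necessarily has query complexity $\Omega(n\log n/\gamma^2)$.
   Context: RANK on inputs of size $n$: there are $n$ elements $a_1,\dots,a_n$ and another special element $b$; for each $i$ there is an unknown underlying order of the pair $(a_i,b)$ (either $a_i<b$ or $a_i>b$). The algorithm may make (adaptively, and with repetition) noisy comparisons of the form $(a_i,b)$ only. The goal is to output the number of elements of $\{a_1,\dots,a_n\}$ that are less than $b$; an output is a $t$-approximation if it is within additive error $t$ of this number. Noisy model with parameter $\gamma$: each comparison independently returns the correct answer with probability $1/2+\gamma/2$ and the incorrect answer with probability $1/2-\gamma/2$. Query complexity is the total number of comparisons (there is no restriction on the number of adaptive rounds). Asymptotics are as $n\to\infty$. An algorithm obtains a $t$-approximation with probability $2/3$ if on every input its output is a $t$-approximation with probability at least $2/3$ over the comparison outcomes and its own randomness.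
   Formalization: The noise parameter γ is restricted to 0 < γ ≤ γ0 for an arbitrary fixed γ0 < 1, and the constant and threshold in Ω may depend on γ0; without this the claim fails, since at γ = 1 (or γ = 1 − 2/n²) n comparisons suffice. *)

theory Defs
  imports "HOL-Probability.Probability"
begin

text \<open>
  Elements are indexed by \<open>i < n\<close>. An input is a function \<open>x\<close> on indices, where \<open>x i\<close> says whether
  \<open>a_i < b\<close> holds (otherwise \<open>a_i > b\<close>); values of \<open>x\<close> at indices \<open>i \<ge> n\<close> are irrelevant.
\<close>

definition num_less :: "nat \<Rightarrow> (nat \<Rightarrow> bool) \<Rightarrow> nat" where
  "num_less n x = card {i. i < n \<and> x i}"

text \<open>
  Deterministic adaptive algorithms are decision trees. \<open>Compare i l r\<close> compares \<open>a_i\<close> with \<open>b\<close> and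
  continues with \<open>l\<close> on the answer \<open>a_i < b\<close> and with \<open>r\<close> on the answer \<open>a_i > b\<close>. The output may
  be any real number, not only a possible value of the rank.
\<close>

datatype dtree = Output real | Compare nat dtree dtree

primrec valid_dtree :: "nat \<Rightarrow> dtree \<Rightarrow> bool" where
  "valid_dtree n (Output y) \<longleftrightarrow> True"
| "valid_dtree n (Compare i l r) \<longleftrightarrow> i < n \<and> valid_dtree n l \<and> valid_dtree n r"

primrec comparisons :: "dtree \<Rightarrow> nat" where
  "comparisons (Output y) = 0"
| "comparisons (Compare i l r) = Suc (max (comparisons l) (comparisons r))"

definition noisy_answer :: "real \<Rightarrow> bool \<Rightarrow> bool pmf" where
  "noisy_answer \<gamma> truth =
     map_pmf (\<lambda>correct. if correct then truth else \<not> truth) (bernoulli_pmf (1 / 2 + \<gamma> / 2))"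

text \<open>
  Distribution of the output on input \<open>x\<close>. Every comparison, repeated ones included, gets fresh
  independent noise.
\<close>

primrec run :: "real \<Rightarrow> (nat \<Rightarrow> bool) \<Rightarrow> dtree \<Rightarrow> real pmf" where
  "run \<gamma> x (Output y) = return_pmf y"
| "run \<gamma> x (Compare i l r) =
     bind_pmf (noisy_answer \<gamma> (x i)) (\<lambda>answer. if answer then run \<gamma> x l else run \<gamma> x r)"

text \<open>
  A randomized algorithm is a probability distribution over decision trees. The sigma-algebra is
  part of the algorithm and only has to make output probabilities measurable, so that arbitrary
  (also continuous) internal randomness is covered. Any distribution with countable support is an
  instance, via \<open>measure_pmf\<close>.
\<close>

definition randomized_algorithm :: "nat \<Rightarrow> real \<Rightarrow> dtree measure \<Rightarrow> bool" where
  "randomized_algorithm n \<gamma> A \<longleftrightarrow>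
     prob_space A \<and>
     (AE T in A. valid_dtree n T) \<and>
     (\<forall>x. \<forall>S\<in>sets borel. (\<lambda>T. measure_pmf.prob (run \<gamma> x T) S) \<in> borel_measurable A)"

definition output_prob :: "real \<Rightarrow> (nat \<Rightarrow> bool) \<Rightarrow> dtree measure \<Rightarrow> real set \<Rightarrow> real" where
  "output_prob \<gamma> x A S = (\<integral>T. measure_pmf.prob (run \<gamma> x T) S \<partial>A)"

definition approximates_rank :: "nat \<Rightarrow> real \<Rightarrow> real \<Rightarrow> real \<Rightarrow> dtree measure \<Rightarrow> bool" where
  "approximates_rank n \<gamma> t p A \<longleftrightarrow>
     (\<forall>x. output_prob \<gamma> x A {y. \<bar>y - real (num_less n x)\<bar> \<le> t} \<ge> p)"

text \<open>
  Worst case over the answers and (up to probability 0) over the internal randomness. For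
  \<open>0 < \<gamma> < 1\<close> every sequence of answers has positive probability on every input, so this is also
  the worst case over inputs.
\<close>

definition query_complexity_le :: "dtree measure \<Rightarrow> nat \<Rightarrow> bool" where
  "query_complexity_le A q \<longleftrightarrow> (AE T in A. comparisons T \<le> q)"

end

theory Submission
  imports Defs "HOL-Real_Asymp.Real_Asymp"
begin

text \<open>
  By averaging it suffices to bound the success of a deterministic tree on a uniformly random input.
  Given the answers, the posterior bits are still independent, each with log-likelihood ratio
  \<open>2 * v i\<close>. Every query raises the expected signed log-likelihood ratio by \<open>O(\<gamma>\<^sup>2)\<close>, so after
  \<open>c * n * ln n / \<gamma>\<^sup>2\<close> queries at least half of the \<open>n\<close> bits most likely have \<open>\<bar>v i\<bar> \<le> ln n / 20\<close>.
  Each of those bits is a fair coin with posterior probability at least \<open>n powr (- 1 / 10)\<close>, so the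
  posterior rank contains a sum of far more than \<open>n powr (3 / 4)\<close> independent fair coins, and an interval
  of length \<open>O(n powr (3 / 8))\<close> captures it only with probability tending to \<open>0\<close>.
\<close>

section \<open>Anti-concentration of sums of independent bits\<close>

lemma sum_Pow_insert:
  fixes f :: "'a set \<Rightarrow> 'b :: comm_monoid_add"
  assumes "finite I" "i \<notin> I"
  shows "(\<Sum>A\<in>Pow (insert i I). f A) = (\<Sum>A\<in>Pow I. f A + f (insert i A))"
proof -
  have inj: "inj_on (insert i) (Pow I)"
    using assms(2) unfolding inj_on_def by (metis Pow_iff insert_ident subsetD)
  have disj: "Pow I \<inter> insert i ` Pow I = {}"
    using assms(2) by auto
  show ?thesis
    using assms(1) by (simp add: Pow_insert sum.union_disjoint disj sum.reindex[OF inj] sum.distrib)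
qed

text \<open>The \<open>m\<close>-th iterate at \<open>k\<close> is the expectation of
  \<open>f\<close> at \<open>k\<close> plus the number of heads in \<open>m\<close> fair coin
  tosses.\<close>

definition avg_shift :: "(nat \<Rightarrow> real) \<Rightarrow> nat \<Rightarrow> real" where
  "avg_shift f k = (f k + f (Suc k)) / 2"

lemma avg_shift_Suc:
  "(avg_shift ^^ Suc m) f k = ((avg_shift ^^ m) f k + (avg_shift ^^ m) f (Suc k)) / 2"
  by (simp add: avg_shift_def[of "(avg_shift ^^ m) f"])

text \<open>An unnormalised product measure on the subsets of \<open>I\<close>. Posterior
  distributions have this form up to a constant, so their normalising factors never have to be
  computed.\<close>

definition bit_weight :: "('a \<Rightarrow> real) \<Rightarrow> ('a \<Rightarrow> real) \<Rightarrow> 'a set \<Rightarrow> 'a set \<Rightarrow> real" where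
  "bit_weight \<alpha> \<beta> I A = (\<Prod>i\<in>I. if i \<in> A then \<alpha> i else \<beta> i)"

lemma bit_weight_insert:
  assumes "finite I" "i \<notin> I" "A \<subseteq> I"
  shows "bit_weight \<alpha> \<beta> (insert i I) A = \<beta> i * bit_weight \<alpha> \<beta> I A"
    and "bit_weight \<alpha> \<beta> (insert i I) (insert i A) = \<alpha> i * bit_weight \<alpha> \<beta> I A"
proof -
  have "i \<notin> A" using assms by auto
  then show "bit_weight \<alpha> \<beta> (insert i I) A = \<beta> i * bit_weight \<alpha> \<beta> I A"
    using assms by (simp add: bit_weight_def)
  have "(\<Prod>j\<in>I. if j \<in> insert i A then \<alpha> j else \<beta> j) = (\<Prod>j\<in>I. if j \<in> A then \<alpha> j else \<beta> j)"
    using assms(2) by (intro prod.cong) auto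
  then show "bit_weight \<alpha> \<beta> (insert i I) (insert i A) = \<alpha> i * bit_weight \<alpha> \<beta> I A"
    using assms by (simp add: bit_weight_def)
qed

lemma sum_bit_weight:
  assumes "finite I"
  shows "(\<Sum>A\<in>Pow I. bit_weight \<alpha> \<beta> I A) = (\<Prod>i\<in>I. \<alpha> i + \<beta> i)"
  using assms
proof (induction I)
  case empty
  then show ?case by (simp add: bit_weight_def)
next
  case (insert i I)
  have "(\<Sum>A\<in>Pow (insert i I). bit_weight \<alpha> \<beta> (insert i I) A)
      = (\<Sum>A\<in>Pow I. (\<alpha> i + \<beta> i) * bit_weight \<alpha> \<beta> I A)"
    unfolding sum_Pow_insert[OF insert.hyps]
    by (intro sum.cong) (auto simp: bit_weight_insert[OF insert.hyps] algebra_simps)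
  then show ?case
    using insert by (simp add: sum_distrib_left[symmetric])
qed

text \<open>
  A bit with weights \<open>\<alpha> i\<close>, \<open>\<beta> i\<close> is a mixture: with probability \<open>2 * min (\<alpha> i) (\<beta> i) / (\<alpha> i + \<beta> i)\<close>
  it is a fair coin, otherwise it is constant. Each fair coin applies \<open>avg_shift\<close> once. The bound
  \<open>a + b / 2 ^ m\<close> has this shape because the expectation of \<open>2 ^ - m\<close> over the random number \<open>m\<close>
  of fair coins is a product.
\<close>

lemma sum_bit_weight_le:
  fixes \<alpha> \<beta> :: "'a \<Rightarrow> real"
  assumes "finite I"
    and pos: "\<And>i. i \<in> I \<Longrightarrow> 0 < \<alpha> i" "\<And>i. i \<in> I \<Longrightarrow> 0 < \<beta> i"
    and bound: "\<And>m k. (avg_shift ^^ m) f k \<le> a + b / 2 ^ m"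
  shows "(\<Sum>A\<in>Pow I. bit_weight \<alpha> \<beta> I A * (avg_shift ^^ m) f (card A + k))
    \<le> (\<Prod>i\<in>I. \<alpha> i + \<beta> i) * (a + b / 2 ^ m * (\<Prod>i\<in>I. 1 - min (\<alpha> i) (\<beta> i) / (\<alpha> i + \<beta> i)))"
  using assms(1) pos
proof (induction I arbitrary: m k)
  case empty
  then show ?case using bound by (simp add: bit_weight_def)
next
  case (insert i I)
  define \<mu> where "\<mu> = min (\<alpha> i) (\<beta> i)"
  define W where "W = (\<Prod>j\<in>I. \<alpha> j + \<beta> j)"
  define R where "R = (\<Prod>j\<in>I. 1 - min (\<alpha> j) (\<beta> j) / (\<alpha> j + \<beta> j))"
  define S where "S m k = (\<Sum>A\<in>Pow I. bit_weight \<alpha> \<beta> I A * (avg_shift ^^ m) f (card A + k))" for m k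
  have IH: "S m k \<le> W * (a + b / 2 ^ m * R)" for m k
    unfolding S_def W_def R_def using insert by simp
  have ab: "0 < \<alpha> i" "0 < \<beta> i" using insert.prems by auto
  have scale: "W * (s * a + z * R * (s * X)) = s * W * (a + z * (X * R))" for s z X
    by (simp add: algebra_simps)
  have "(\<Sum>A\<in>Pow (insert i I). bit_weight \<alpha> \<beta> (insert i I) A * (avg_shift ^^ m) f (card A + k))
    = (\<Sum>A\<in>Pow I. 2 * \<mu> * (bit_weight \<alpha> \<beta> I A * (avg_shift ^^ Suc m) f (card A + k))
        + (\<alpha> i - \<mu>) * (bit_weight \<alpha> \<beta> I A * (avg_shift ^^ m) f (card A + Suc k))
        + (\<beta> i - \<mu>) * (bit_weight \<alpha> \<beta> I A * (avg_shift ^^ m) f (card A + k)))"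
    unfolding sum_Pow_insert[OF insert.hyps]
  proof (intro sum.cong refl)
    fix A assume "A \<in> Pow I"
    then have A: "A \<subseteq> I" "finite A" "i \<notin> A"
      using insert.hyps by (auto intro: finite_subset)
    show "bit_weight \<alpha> \<beta> (insert i I) A * (avg_shift ^^ m) f (card A + k)
        + bit_weight \<alpha> \<beta> (insert i I) (insert i A) * (avg_shift ^^ m) f (card (insert i A) + k)
      = 2 * \<mu> * (bit_weight \<alpha> \<beta> I A * (avg_shift ^^ Suc m) f (card A + k))
        + (\<alpha> i - \<mu>) * (bit_weight \<alpha> \<beta> I A * (avg_shift ^^ m) f (card A + Suc k))
        + (\<beta> i - \<mu>) * (bit_weight \<alpha> \<beta> I A * (avg_shift ^^ m) f (card A + k))"
      using A by (simp add: bit_weight_insert[OF insert.hyps A(1)] avg_shift_Suc del: funpow.simps)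
        (simp add: algebra_simps)
  qed
  also have "\<dots> = 2 * \<mu> * S (Suc m) k + (\<alpha> i - \<mu>) * S m (Suc k) + (\<beta> i - \<mu>) * S m k"
    by (simp only: sum.distrib sum_distrib_left[symmetric] S_def)
  also have "\<dots> \<le> 2 * \<mu> * (W * (a + b / 2 ^ Suc m * R)) + (\<alpha> i - \<mu>) * (W * (a + b / 2 ^ m * R))
      + (\<beta> i - \<mu>) * (W * (a + b / 2 ^ m * R))"
    by (intro add_mono mult_left_mono IH) (use ab in \<open>auto simp: \<mu>_def\<close>)
  \<comment> \<open>The fair branch has mass \<open>2 * \<mu>\<close> but one more coin, which
    halves its error term. The coefficient of that term is therefore
    \<open>\<mu> + (\<alpha> i - \<mu>) + (\<beta> i - \<mu>)\<close>.\<close>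
  also have "\<dots> = W * ((\<alpha> i + \<beta> i) * a + b / 2 ^ m * R * (\<alpha> i + \<beta> i - \<mu>))"
    by (simp add: algebra_simps add_divide_distrib diff_divide_distrib)
  also have "\<alpha> i + \<beta> i - \<mu> = (\<alpha> i + \<beta> i) * (1 - \<mu> / (\<alpha> i + \<beta> i))"
    using ab by (simp add: right_diff_distrib)
  also have "W * ((\<alpha> i + \<beta> i) * a + b / 2 ^ m * R * ((\<alpha> i + \<beta> i) * (1 - \<mu> / (\<alpha> i + \<beta> i))))
      = (\<alpha> i + \<beta> i) * W * (a + b / 2 ^ m * ((1 - \<mu> / (\<alpha> i + \<beta> i)) * R))"
    by (rule scale)
  finally show ?case
    using insert.hyps by (simp add: W_def R_def \<mu>_def)
qed

section \<open>Interval probabilities for sums of fair coins\<close>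

lemma avg_shift_mono:
  assumes "\<And>k. (avg_shift ^^ m) f k \<le> c"
  shows "(avg_shift ^^ (m + j)) f k \<le> c"
proof (induction j arbitrary: k)
  case 0
  then show ?case using assms by simp
next
  case (Suc j)
  show ?case
    using Suc[of k] Suc[of "Suc k"] unfolding add_Suc_right avg_shift_Suc by simp
qed

lemma avg_shift_binomial:
  "(avg_shift ^^ m) f k = (\<Sum>j\<le>m. real (m choose j) * f (k + j)) / 2 ^ m"
proof (induction m arbitrary: k)
  case 0
  then show ?case by simp
next
  case (Suc m)
  have "(\<Sum>j\<le>Suc m. real (Suc m choose j) * f (k + j))
      = f k + (\<Sum>j\<le>m. real (Suc m choose Suc j) * f (k + Suc j))"
    by (subst sum.atMost_Suc_shift) simp
  also have "\<dots> = (f k + (\<Sum>j\<le>m. real (m choose Suc j) * f (k + Suc j)))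
      + (\<Sum>j\<le>m. real (m choose j) * f (k + Suc j))"
    by (simp add: sum.distrib algebra_simps)
  also have "f k + (\<Sum>j\<le>m. real (m choose Suc j) * f (k + Suc j))
      = (\<Sum>j\<le>Suc m. real (m choose j) * f (k + j))"
    by (subst sum.atMost_Suc_shift) simp
  also have "\<dots> = (\<Sum>j\<le>m. real (m choose j) * f (k + j))"
    by simp
  finally show ?case
    unfolding avg_shift_Suc Suc.IH by (simp add: add_divide_distrib)
qed

text \<open>The square of the left side times \<open>2 * k + 1\<close> equals 1 at
  \<open>k = 0\<close> and never increases, because each step multiplies it by
  \<open>(2 * k + 1) * (2 * k + 3) / (2 * k + 2)\<^sup>2\<close>, which is at most 1.\<close>

lemma central_binomial_upper_bound: "real ((2 * k) choose k) / 4 ^ k \<le> 1 / sqrt (2 * real k + 1)"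
proof -
  have rec: "real ((2 * Suc k) choose Suc k) * (real k + 1) = 2 * (2 * real k + 1) * real ((2 * k) choose k)" for k
  proof -
    have 1: "Suc k * ((2 * k + 2) choose Suc k) = (2 * k + 2) * ((2 * k + 1) choose k)"
      using Suc_times_binomial_eq[of "2 * k + 1" k] by simp
    have "(2 * k + 1) choose k = (2 * k + 1) choose Suc k"
      using binomial_symmetric[of k "2 * k + 1"] by simp
    moreover have "Suc k * ((2 * k + 1) choose Suc k) = (2 * k + 1) * ((2 * k) choose k)"
      using Suc_times_binomial_eq[of "2 * k" k] by simp
    ultimately have "Suc k * (Suc k * ((2 * k + 2) choose Suc k)) = (2 * k + 2) * ((2 * k + 1) * ((2 * k) choose k))"
      using 1 by (metis mult.left_commute)
    also have "(2 * k + 2) * ((2 * k + 1) * ((2 * k) choose k)) = Suc k * (2 * ((2 * k + 1) * ((2 * k) choose k)))"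
      by simp
    finally have "Suc k * ((2 * k + 2) choose Suc k) = 2 * ((2 * k + 1) * ((2 * k) choose k))"
      by (simp only: mult_left_cancel[OF Suc_not_Zero])
    then have "real (Suc k * ((2 * k + 2) choose Suc k)) = real (2 * ((2 * k + 1) * ((2 * k) choose k)))"
      by (rule arg_cong)
    then show ?thesis by (simp add: algebra_simps)
  qed
  have "(real ((2 * k) choose k) / 4 ^ k)\<^sup>2 * (2 * real k + 1) \<le> 1"
  proof (induction k)
    case 0
    then show ?case by simp
  next
    case (Suc k)
    define c where "c = real ((2 * k) choose k) / 4 ^ k"
    have "X / 4 ^ Suc k = c * ((2 * real k + 1) / (2 * real k + 2))"
      if "X * (real k + 1) = 2 * (2 * real k + 1) * real ((2 * k) choose k)" for X
    proof -
      have "X / (4 * P) = C / P * (m / (2 * r))"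
        if "X * r = 2 * m * C" "r \<noteq> 0" "P \<noteq> 0" for P C m r :: real
        using that by (simp add: field_simps)
      from this[OF that, of "4 ^ k"] have "X / 4 ^ Suc k = c * ((2 * real k + 1) / (2 * (real k + 1)))"
        by (simp add: c_def add_pos_nonneg del: distrib_left_numeral)
      then show ?thesis
        by (simp add: distrib_left)
    qed
    note ratio = this[OF rec]
    have Suc_k: "2 * real (Suc k) + 1 = 2 * real k + 3" by simp
    have "(x * (m / r))\<^sup>2 * w = (x\<^sup>2 * m) * (m * w / r\<^sup>2)" for x m r w :: real
      by (simp add: power2_eq_square)
    then have "(real ((2 * Suc k) choose Suc k) / 4 ^ Suc k)\<^sup>2 * (2 * real (Suc k) + 1)
        = (c\<^sup>2 * (2 * real k + 1)) * ((2 * real k + 1) * (2 * real k + 3) / (2 * real k + 2)\<^sup>2)"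
      unfolding ratio Suc_k .
    also have "\<dots> \<le> 1 * 1"
      using Suc.IH unfolding c_def[symmetric]
    proof (intro mult_mono)
      have "(2 * real k + 1) * (2 * real k + 3) \<le> (2 * real k + 2)\<^sup>2"
        by (simp add: power2_eq_square algebra_simps)
      moreover have "0 < (2 * real k + 2)\<^sup>2"
        by (intro zero_less_power) linarith
      ultimately show "(2 * real k + 1) * (2 * real k + 3) / (2 * real k + 2)\<^sup>2 \<le> 1"
        by (simp only: divide_le_eq_1_pos)
    qed auto
    finally show ?case by simp
  qed
  then have "(real ((2 * k) choose k) / 4 ^ k * sqrt (2 * real k + 1))\<^sup>2 \<le> 1\<^sup>2"
    by (subst power_mult_distrib) simp
  then have "real ((2 * k) choose k) / 4 ^ k * sqrt (2 * real k + 1) \<le> 1"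
    by (rule power2_le_imp_le) simp
  then show ?thesis
    by (simp add: field_simps add_pos_nonneg)
qed

lemma card_nat_interval_le:
  fixes S :: "nat set"
  assumes "finite S" "0 \<le> t" and S: "\<And>j. j \<in> S \<Longrightarrow> \<bar>real j - y\<bar> \<le> t"
  shows "real (card S) \<le> 2 * t + 1"
proof (cases "S = {}")
  case False
  have "S \<subseteq> {Min S..Max S}"
    using assms(1) by auto
  then have "card S \<le> card {Min S..Max S}"
    by (intro card_mono) auto
  then have "real (card S) \<le> real (Max S) + 1 - real (Min S)"
    using Min_le[OF assms(1) Max_in[OF assms(1) False]] by simp
  also have "\<dots> \<le> 2 * t + 1"
    using S[OF Max_in[OF assms(1) False]] S[OF Min_in[OF assms(1) False]] by linarith
  finally show ?thesis .
qed (use assms in simp)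

text \<open>The interval contains at most \<open>2 * t + 1\<close> integers. After
  \<open>2 * K\<close> coins each of them has at most the central binomial probability, and further
  coins only average this bound. With fewer than \<open>2 * K\<close> coins the second summand is at
  least 1, so the bound is trivial. The sum has the shape \<open>a + b / 2 ^ m\<close> required by
  \<open>sum_bit_weight_le\<close>.\<close>

lemma avg_shift_interval_le:
  fixes y t :: real
  defines "f \<equiv> \<lambda>k::nat. indicator {z. \<bar>y - z\<bar> \<le> t} (real k)"
  assumes "0 \<le> t"
  shows "(avg_shift ^^ m) f k \<le> (2 * t + 1) / sqrt (2 * real K + 1) + 4 ^ K / 2 ^ m"
proof (cases "m < 2 * K")
  case True
  have "(avg_shift ^^ (0 + m)) f k \<le> 1"
    by (rule avg_shift_mono) (simp add: f_def indicator_def)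
  also have "1 \<le> (4 ^ K / 2 ^ m :: real)"
    using True power_increasing[of m "2 * K" "2::real"] by (simp add: power_mult)
  finally show ?thesis
    using \<open>0 \<le> t\<close> by (simp add: add_increasing)
next
  case False
  have "(avg_shift ^^ (2 * K)) f k \<le> (2 * t + 1) / sqrt (2 * real K + 1)" for k
  proof -
    define S where "S = {j. j \<le> 2 * K \<and> \<bar>y - real (k + j)\<bar> \<le> t}"
    have S: "finite S" "real (card S) \<le> 2 * t + 1"
    proof -
      show "finite S" unfolding S_def by auto
      show "real (card S) \<le> 2 * t + 1"
        using \<open>0 \<le> t\<close> by (intro card_nat_interval_le[where y = "y - real k"]) (auto simp: S_def)
    qed
    have "(\<Sum>j\<le>2 * K. real ((2 * K) choose j) * f (k + j)) = (\<Sum>j\<in>S. real ((2 * K) choose j))"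
      unfolding S_def f_def by (intro sum.mono_neutral_cong_right) auto
    also have "\<dots> \<le> (\<Sum>j\<in>S. real ((2 * K) choose K))"
      using binomial_maximum[of "2 * K"] by (intro sum_mono) simp
    also have "\<dots> \<le> (2 * t + 1) * real ((2 * K) choose K)"
      using S by (simp add: mult_right_mono)
    finally have "(avg_shift ^^ (2 * K)) f k \<le> (2 * t + 1) * (real ((2 * K) choose K) / 4 ^ K)"
      unfolding avg_shift_binomial by (simp add: power_mult divide_right_mono)
    also have "\<dots> \<le> (2 * t + 1) * (1 / sqrt (2 * real K + 1))"
      using \<open>0 \<le> t\<close> by (intro mult_left_mono central_binomial_upper_bound) auto
    finally show ?thesis by simp
  qed
  from avg_shift_mono[of "2 * K" f, OF this, of "m - 2 * K" k] False
  show ?thesis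
    by (simp add: add_increasing2)
qed

text \<open>A bit with \<open>\<bar>v i\<bar> \<le> B\<close> is a fair coin with probability at
  least \<open>exp (- 2 * B)\<close>. By \<open>1 - u \<le> exp (- u)\<close>, the product over all
  bits decays exponentially in the number of such bits.\<close>

lemma exp_weight_concentration:
  fixes v :: "'a \<Rightarrow> real" and y t :: real
  defines "w \<equiv> bit_weight (\<lambda>i. exp (v i)) (\<lambda>i. exp (- v i))"
  assumes "finite I" "0 \<le> t"
  shows "(\<Sum>A\<in>Pow I. w I A * indicator {z. \<bar>y - z\<bar> \<le> t} (real (card A)))
    \<le> ((2 * t + 1) / sqrt (2 * real K + 1)
        + 4 ^ K * exp (- (real (card {i \<in> I. \<bar>v i\<bar> \<le> B}) * exp (- 2 * B) / 2)))
      * (\<Sum>A\<in>Pow I. w I A)"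
proof -
  \<comment> \<open>Half the probability that bit \<open>i\<close> acts as a fair coin.\<close>
  define \<rho> where "\<rho> i = min (exp (v i)) (exp (- v i)) / (exp (v i) + exp (- v i))" for i
  define G where "G = {i \<in> I. \<bar>v i\<bar> \<le> B}"
  have \<rho>: "exp (- 2 * \<bar>v i\<bar>) / 2 \<le> \<rho> i" "0 \<le> \<rho> i" "\<rho> i \<le> 1" for i
  proof -
    have pos: "0 < exp (v i) + exp (- v i)"
      by (simp add: add_pos_pos)
    have "exp (- 2 * \<bar>v i\<bar>) * (exp (v i) + exp (- v i)) \<le> exp (- 2 * \<bar>v i\<bar>) * (2 * exp \<bar>v i\<bar>)"
      by (intro mult_left_mono) (auto simp: abs_if intro: add_mono[of _ x _ x for x, simplified])
    also have "\<dots> = 2 * exp (- \<bar>v i\<bar>)"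
      by (simp add: exp_add[symmetric])
    also have "exp (- \<bar>v i\<bar>) = min (exp (v i)) (exp (- v i))"
      by (simp add: abs_if min_def)
    finally show "exp (- 2 * \<bar>v i\<bar>) / 2 \<le> \<rho> i"
      using pos unfolding \<rho>_def by (simp add: field_simps)
    show "0 \<le> \<rho> i" "\<rho> i \<le> 1"
      using pos unfolding \<rho>_def by (auto simp: min_def divide_simps)
  qed
  have "(\<Prod>i\<in>I. 1 - \<rho> i) \<le> (\<Prod>i\<in>I. exp (- \<rho> i))"
    using \<rho> by (intro prod_mono) (auto simp: intro: order_trans[OF _ exp_ge_add_one_self])
  also have "\<dots> = exp (- (\<Sum>i\<in>I. \<rho> i))"
    using \<open>finite I\<close> by (simp add: exp_sum sum_negf[symmetric])
  also have "\<dots> \<le> exp (- (real (card G) * exp (- 2 * B) / 2))"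
  proof -
    have "real (card G) * exp (- 2 * B) / 2 = (\<Sum>i\<in>G. exp (- 2 * B) / 2)" by simp
    also have "\<dots> \<le> (\<Sum>i\<in>G. \<rho> i)"
      by (intro sum_mono order_trans[OF _ \<rho>(1)]) (auto simp: G_def)
    also have "\<dots> \<le> (\<Sum>i\<in>I. \<rho> i)"
      using \<open>finite I\<close> \<rho>(2) by (intro sum_mono2) (auto simp: G_def)
    finally show ?thesis by simp
  qed
  finally have prod: "(\<Prod>i\<in>I. 1 - \<rho> i) \<le> exp (- (real (card G) * exp (- 2 * B) / 2))" .
  have "(\<Sum>A\<in>Pow I. w I A * indicator {z. \<bar>y - z\<bar> \<le> t} (real (card A)))
    \<le> (\<Prod>i\<in>I. exp (v i) + exp (- v i))
      * ((2 * t + 1) / sqrt (2 * real K + 1) + 4 ^ K * (\<Prod>i\<in>I. 1 - \<rho> i))"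
    using sum_bit_weight_le[OF \<open>finite I\<close> _ _ avg_shift_interval_le[OF \<open>0 \<le> t\<close>, where y = y and K = K],
        of "\<lambda>i. exp (v i)" "\<lambda>i. exp (- v i)" 0 0]
    by (simp add: w_def \<rho>_def)
  also have "\<dots> \<le> (\<Prod>i\<in>I. exp (v i) + exp (- v i))
      * ((2 * t + 1) / sqrt (2 * real K + 1) + 4 ^ K * exp (- (real (card G) * exp (- 2 * B) / 2)))"
    by (intro mult_left_mono add_left_mono prod prod_nonneg) (auto intro: add_nonneg_nonneg)
  finally show ?thesis
    unfolding w_def sum_bit_weight[OF \<open>finite I\<close>] G_def by (simp add: mult.commute)
qed

section \<open>Posterior weights along a run\<close>

definition yes_prob :: "real \<Rightarrow> bool \<Rightarrow> real" where
  "yes_prob \<gamma> truth = (if truth then 1 / 2 + \<gamma> / 2 else 1 / 2 - \<gamma> / 2)"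

text \<open>The change of \<open>v i\<close> caused by one answer. Halving the log-odds lets the
  likelihood ratio be shared symmetrically between \<open>exp (v i)\<close> and
  \<open>exp (- v i)\<close>.\<close>

definition half_log_odds :: "real \<Rightarrow> real" where
  "half_log_odds \<gamma> = (ln (1 / 2 + \<gamma> / 2) - ln (1 / 2 - \<gamma> / 2)) / 2"

text \<open>
  The state \<open>v i\<close> is half the log-likelihood ratio of \<open>a_i < b\<close> against \<open>a_i > b\<close> given the answers
  so far. Hence the probability of a path on input \<open>x\<close> is, up to a factor independent of \<open>x\<close>, the
  product of \<open>exp (v i)\<close> over \<open>x i\<close> and \<open>exp (- v i)\<close> over \<open>\<not> x i\<close>.
\<close>

primrec leaf_expectation ::
    "real \<Rightarrow> (nat \<Rightarrow> bool) \<Rightarrow> ((nat \<Rightarrow> real) \<Rightarrow> real \<Rightarrow> real) \<Rightarrow> dtree \<Rightarrow> (nat \<Rightarrow> real) \<Rightarrow> real" where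
  "leaf_expectation \<gamma> x G (Output y) v = G v y"
| "leaf_expectation \<gamma> x G (Compare i l r) v =
     yes_prob \<gamma> (x i) * leaf_expectation \<gamma> x G l (v(i := v i + half_log_odds \<gamma>))
     + (1 - yes_prob \<gamma> (x i)) * leaf_expectation \<gamma> x G r (v(i := v i - half_log_odds \<gamma>))"

lemma yes_prob_bounds:
  assumes "0 < \<gamma>" "\<gamma> < 1"
  shows "0 \<le> yes_prob \<gamma> b" "0 \<le> 1 - yes_prob \<gamma> b"
  using assms by (auto simp: yes_prob_def)

lemma noisy_answer_bernoulli:
  assumes "0 < \<gamma>" "\<gamma> < 1"
  shows "noisy_answer \<gamma> truth = bernoulli_pmf (yes_prob \<gamma> truth)"
proof (rule pmf_eqI)
  fix b
  show "pmf (noisy_answer \<gamma> truth) b = pmf (bernoulli_pmf (yes_prob \<gamma> truth)) b"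
  proof (cases truth)
    case True
    then show ?thesis by (simp add: noisy_answer_def yes_prob_def map_pmf_ident)
  next
    case False
    then show ?thesis
      using assms pmf_map_inj'[of Not "bernoulli_pmf (1 / 2 + \<gamma> / 2)" "\<not> b"]
      by (cases b) (auto simp: noisy_answer_def yes_prob_def inj_on_def)
  qed
qed

text \<open>The indicator ignores the state, so tracking \<open>v\<close> changes nothing and any
  starting state is allowed.\<close>

lemma prob_run_eq_leaf_expectation:
  assumes "0 < \<gamma>" "\<gamma> < 1"
  shows "measure_pmf.prob (run \<gamma> x T) S = leaf_expectation \<gamma> x (\<lambda>_ y. indicator S y) T v"
proof (induction T arbitrary: v)
  case (Output y)
  then show ?case by (simp add: indicator_def)
next
  case (Compare i l r)
  have p: "0 \<le> yes_prob \<gamma> (x i)" "yes_prob \<gamma> (x i) \<le> 1"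
    using yes_prob_bounds[OF assms] by auto
  have "ennreal (measure_pmf.prob (run \<gamma> x (Compare i l r)) S)
      = ennreal (measure_pmf.prob (run \<gamma> x l) S) * ennreal (yes_prob \<gamma> (x i))
        + ennreal (measure_pmf.prob (run \<gamma> x r) S) * ennreal (1 - yes_prob \<gamma> (x i))"
    using p by (simp add: measure_pmf.emeasure_eq_measure[symmetric] noisy_answer_bernoulli[OF assms])
  also have "\<dots> = ennreal (measure_pmf.prob (run \<gamma> x l) S * yes_prob \<gamma> (x i)
        + measure_pmf.prob (run \<gamma> x r) S * (1 - yes_prob \<gamma> (x i)))"
    using p by (simp add: ennreal_mult)
  finally have "measure_pmf.prob (run \<gamma> x (Compare i l r)) S
      = measure_pmf.prob (run \<gamma> x l) S * yes_prob \<gamma> (x i)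
        + measure_pmf.prob (run \<gamma> x r) S * (1 - yes_prob \<gamma> (x i))"
    using p by (subst (asm) ennreal_inj) auto
  also have "\<dots> = leaf_expectation \<gamma> x (\<lambda>_ y. indicator S y) (Compare i l r) v"
    unfolding leaf_expectation.simps
      Compare.IH(1)[of "v(i := v i + half_log_odds \<gamma>)"]
      Compare.IH(2)[of "v(i := v i - half_log_odds \<gamma>)"]
    by (simp only: mult.commute)
  finally show ?case .
qed

lemma leaf_expectation_mono:
  assumes "0 < \<gamma>" "\<gamma> < 1" and "\<And>v y. G v y \<le> H v y"
  shows "leaf_expectation \<gamma> x G T v \<le> leaf_expectation \<gamma> x H T v"
proof (induction T arbitrary: v)
  case (Output y)
  then show ?case using assms by simp
next
  case (Compare i l r)
  then show ?case
    using yes_prob_bounds[OF assms(1,2)] by (auto intro!: add_mono mult_left_mono)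
qed

abbreviation input_weight :: "nat \<Rightarrow> (nat \<Rightarrow> real) \<Rightarrow> nat set \<Rightarrow> real" where
  "input_weight n v A \<equiv> bit_weight (\<lambda>i. exp (v i)) (\<lambda>i. exp (- v i)) {..<n} A"

lemma input_weight_update:
  assumes "i < n"
  shows "input_weight n (v(i := v i + d)) A = exp (if i \<in> A then d else - d) * input_weight n v A"
proof -
  have "(\<Prod>j\<in>{..<n} - {i}. if j \<in> A then exp ((v(i := v i + d)) j) else exp (- (v(i := v i + d)) j))
      = (\<Prod>j\<in>{..<n} - {i}. if j \<in> A then exp (v j) else exp (- v j))"
    by (rule prod.cong) auto
  then have "input_weight n (v(i := v i + d)) A
      = (if i \<in> A then exp (v i + d) else exp (- (v i + d)))
        * (\<Prod>j\<in>{..<n} - {i}. if j \<in> A then exp (v j) else exp (- v j))"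
    using assms unfolding bit_weight_def by (subst prod.remove[of _ i]) (simp_all del: fun_upd_apply add: fun_upd_same)
  moreover have "input_weight n v A = (if i \<in> A then exp (v i) else exp (- v i))
        * (\<Prod>j\<in>{..<n} - {i}. if j \<in> A then exp (v j) else exp (- v j))"
    using assms unfolding bit_weight_def by (subst prod.remove[of _ i]) auto
  ultimately show ?thesis
    by (simp add: exp_add exp_diff exp_minus field_simps)
qed

text \<open>Bayes' rule. As \<open>\<kappa>\<close> is the geometric mean of the two answer
  probabilities, these are \<open>\<kappa> * exp (half_log_odds \<gamma>)\<close> and
  \<open>\<kappa> * exp (- half_log_odds \<gamma>)\<close>. The exponentials go into the weights,
  leaving a factor that depends neither on the input nor on the answer.\<close>

lemma yes_prob_mult_input_weight:
  fixes \<gamma> :: real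
  defines "\<kappa> \<equiv> exp ((ln (1 / 2 + \<gamma> / 2) + ln (1 / 2 - \<gamma> / 2)) / 2)"
  assumes "0 < \<gamma>" "\<gamma> < 1" "i < n"
  shows "yes_prob \<gamma> (i \<in> A) * input_weight n v A = \<kappa> * input_weight n (v(i := v i + half_log_odds \<gamma>)) A"
    and "(1 - yes_prob \<gamma> (i \<in> A)) * input_weight n v A
      = \<kappa> * input_weight n (v(i := v i - half_log_odds \<gamma>)) A"
proof -
  have "\<kappa> * exp (half_log_odds \<gamma>) = exp (ln (1 / 2 + \<gamma> / 2))"
    unfolding \<kappa>_def half_log_odds_def exp_add[symmetric] by (simp add: field_simps)
  then have 1: "\<kappa> * exp (half_log_odds \<gamma>) = 1 / 2 + \<gamma> / 2"
    using assms by simp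
  have "\<kappa> * exp (- half_log_odds \<gamma>) = exp (ln (1 / 2 - \<gamma> / 2))"
    unfolding \<kappa>_def half_log_odds_def exp_add[symmetric] by (simp add: field_simps)
  then have 2: "\<kappa> * exp (- half_log_odds \<gamma>) = 1 / 2 - \<gamma> / 2"
    using assms by simp
  show "yes_prob \<gamma> (i \<in> A) * input_weight n v A = \<kappa> * input_weight n (v(i := v i + half_log_odds \<gamma>)) A"
    unfolding input_weight_update[OF \<open>i < n\<close>] mult.assoc[symmetric]
    by (cases "i \<in> A") (simp_all add: 1 2 yes_prob_def)
  have down: "input_weight n (v(i := v i - half_log_odds \<gamma>)) A
      = exp (if i \<in> A then - half_log_odds \<gamma> else half_log_odds \<gamma>) * input_weight n v A"
    using input_weight_update[OF \<open>i < n\<close>, of v "- half_log_odds \<gamma>" A] by simp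
  show "(1 - yes_prob \<gamma> (i \<in> A)) * input_weight n v A
      = \<kappa> * input_weight n (v(i := v i - half_log_odds \<gamma>)) A"
    unfolding down mult.assoc[symmetric]
    by (cases "i \<in> A") (simp_all add: 1 2 yes_prob_def)
qed

text \<open>The branching and the output of the tree depend on the input only through the answers.
  Moving the answer probabilities into the weights splits the sum at each comparison into two sums
  of the same form. Hence the inequality is needed only at the leaves, averaged over the posterior
  there, and not for each input separately.\<close>

lemma sum_leaf_expectation_mono:
  assumes "0 < \<gamma>" "\<gamma> < 1" "valid_dtree n T"
    and leaf: "\<And>v y. (\<Sum>A\<in>Pow {..<n}. input_weight n v A * G A v y)
      \<le> (\<Sum>A\<in>Pow {..<n}. input_weight n v A * H A v y)"
  shows "(\<Sum>A\<in>Pow {..<n}. input_weight n v A * leaf_expectation \<gamma> (\<lambda>i. i \<in> A) (G A) T v)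
    \<le> (\<Sum>A\<in>Pow {..<n}. input_weight n v A * leaf_expectation \<gamma> (\<lambda>i. i \<in> A) (H A) T v)"
  using assms(3)
proof (induction T arbitrary: v)
  case (Output y)
  then show ?case using leaf by simp
next
  case (Compare i l r)
  define \<kappa> where "\<kappa> = exp ((ln (1 / 2 + \<gamma> / 2) + ln (1 / 2 - \<gamma> / 2)) / 2)"
  define v1 where "v1 = v(i := v i + half_log_odds \<gamma>)"
  define v2 where "v2 = v(i := v i - half_log_odds \<gamma>)"
  have i: "i < n" "valid_dtree n l" "valid_dtree n r"
    using Compare.prems by auto
  note w = yes_prob_mult_input_weight[OF assms(1,2) i(1), where v = v, folded \<kappa>_def v1_def v2_def]
  have split: "(\<Sum>A\<in>Pow {..<n}. input_weight n v A * leaf_expectation \<gamma> (\<lambda>i. i \<in> A) (F A) (Compare i l r) v)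
    = \<kappa> * (\<Sum>A\<in>Pow {..<n}. input_weight n v1 A * leaf_expectation \<gamma> (\<lambda>i. i \<in> A) (F A) l v1)
      + \<kappa> * (\<Sum>A\<in>Pow {..<n}. input_weight n v2 A * leaf_expectation \<gamma> (\<lambda>i. i \<in> A) (F A) r v2)" for F
  proof -
    have "input_weight n v A * leaf_expectation \<gamma> (\<lambda>i. i \<in> A) (F A) (Compare i l r) v
      = yes_prob \<gamma> (i \<in> A) * input_weight n v A * leaf_expectation \<gamma> (\<lambda>i. i \<in> A) (F A) l v1
      + (1 - yes_prob \<gamma> (i \<in> A)) * input_weight n v A * leaf_expectation \<gamma> (\<lambda>i. i \<in> A) (F A) r v2" for A
      by (simp only: leaf_expectation.simps v1_def v2_def distrib_left mult_ac)
    then show ?thesis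
      by (simp only: w sum.distrib sum_distrib_left mult.assoc)
  qed
  show ?case
    unfolding split
    by (intro add_mono mult_left_mono Compare.IH i) (simp_all add: \<kappa>_def)
qed

section \<open>Growth of the log-likelihood ratios\<close>

text \<open>Here \<open>2 * z\<close> is the log-likelihood ratio in favour of the truth. Its drift
  is computable, but a bound on \<open>2 * \<bar>z\<bar>\<close> is wanted. The term
  \<open>2 * exp (- 2 * z)\<close> pays for evidence pointing the wrong way and adds no
  drift.\<close>

definition likelihood_potential :: "nat \<Rightarrow> (nat \<Rightarrow> bool) \<Rightarrow> (nat \<Rightarrow> real) \<Rightarrow> real" where
  "likelihood_potential n x v =
     (\<Sum>i<n. let z = (if x i then v i else - v i) in 2 * z + 2 * exp (- 2 * z))"

lemma sum_abs_le_likelihood_potential: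
  "(\<Sum>i<n. 2 * \<bar>v i\<bar>) \<le> likelihood_potential n x v"
proof -
  have *: "2 * \<bar>z\<bar> \<le> 2 * z + 2 * exp (- 2 * z)" for z :: real
  proof (cases "0 \<le> z")
    case False
    then show ?thesis using exp_ge_add_one_self[of "- 2 * z"] by simp
  qed simp
  show ?thesis
    unfolding likelihood_potential_def
  proof (rule sum_mono)
    fix i
    show "2 * \<bar>v i\<bar> \<le> (let z = if x i then v i else - v i in 2 * z + 2 * exp (- 2 * z))"
      using *[of "v i"] *[of "- v i"] by (cases "x i") (simp_all add: Let_def)
  qed
qed

lemma exp_two_half_log_odds:
  assumes "0 < \<gamma>" "\<gamma> < 1"
  shows "exp (2 * half_log_odds \<gamma>) = (1 + \<gamma>) / (1 - \<gamma>)"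
proof -
  have "2 * half_log_odds \<gamma> = ln (1 / 2 + \<gamma> / 2) - ln (1 / 2 - \<gamma> / 2)"
    by (simp add: half_log_odds_def)
  then have "exp (2 * half_log_odds \<gamma>) = (1 / 2 + \<gamma> / 2) / (1 / 2 - \<gamma> / 2)"
    using assms by (simp only: exp_diff) simp
  then show ?thesis using assms by (simp add: field_simps)
qed

text \<open>Makes the drift \<open>2 * \<gamma> * half_log_odds \<gamma>\<close> of order
  \<open>\<gamma>\<^sup>2\<close> as long as \<gamma> stays away from 1. It follows from
  \<open>1 + u \<le> exp u\<close>.\<close>

lemma half_log_odds_le:
  assumes "0 < \<gamma>" "\<gamma> < 1"
  shows "2 * half_log_odds \<gamma> \<le> 2 * \<gamma> / (1 - \<gamma>)"
proof -
  have "1 + 2 * half_log_odds \<gamma> \<le> (1 + \<gamma>) / (1 - \<gamma>)"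
    using exp_ge_add_one_self[of "2 * half_log_odds \<gamma>"] exp_two_half_log_odds[OF assms] by simp
  then show ?thesis using assms by (simp add: field_simps)
qed

text \<open>
  The signed log-likelihood ratio of an element drifts by exactly \<open>2 * \<gamma> * half_log_odds \<gamma>\<close> whenever
  the element is queried, and the inverse likelihood ratio is a martingale.
\<close>

lemma likelihood_potential_step:
  assumes "0 < \<gamma>" "\<gamma> < 1" "i < n"
  defines "h \<equiv> half_log_odds \<gamma>"
  shows "yes_prob \<gamma> (x i) * likelihood_potential n x (v(i := v i + h))
      + (1 - yes_prob \<gamma> (x i)) * likelihood_potential n x (v(i := v i - h))
    = likelihood_potential n x v + 2 * \<gamma> * h"
proof -
  define \<psi> where "\<psi> b z = (let z = (if b then z else - z) in 2 * z + 2 * exp (- 2 * z))" for b and z :: real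
  define R where "R = (\<Sum>j\<in>{..<n} - {i}. \<psi> (x j) (v j))"
  have upd: "likelihood_potential n x (v(i := z)) = \<psi> (x i) z + R" for z
  proof -
    have "(\<Sum>j\<in>{..<n} - {i}. \<psi> (x j) ((v(i := z)) j)) = R"
      unfolding R_def by (rule sum.cong) auto
    moreover have "likelihood_potential n x (v(i := z)) = (\<Sum>j<n. \<psi> (x j) ((v(i := z)) j))"
      by (simp only: likelihood_potential_def \<psi>_def)
    ultimately show ?thesis
      using assms(3) by (simp only: sum.remove[of "{..<n}" i] finite_lessThan lessThan_iff fun_upd_same)
  qed
  have e1: "exp (2 * h) = (1 + \<gamma>) / (1 - \<gamma>)"
    using exp_two_half_log_odds[OF assms(1,2)] by (simp add: h_def)
  have e2: "exp (- (2 * h)) = (1 - \<gamma>) / (1 + \<gamma>)"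
    unfolding exp_minus e1 by simp
  have m1: "exp (- 2 * (z + h)) = exp (- 2 * z) * ((1 - \<gamma>) / (1 + \<gamma>))" for z
    unfolding e2[symmetric] exp_add[symmetric] by (simp add: algebra_simps)
  have m2: "exp (- 2 * (z - h)) = exp (- 2 * z) * ((1 + \<gamma>) / (1 - \<gamma>))" for z
    unfolding e1[symmetric] exp_add[symmetric] by (simp add: algebra_simps)
  have core: "(1 / 2 + \<gamma> / 2) * (2 * (z + h) + 2 * exp (- 2 * (z + h)))
      + (1 / 2 - \<gamma> / 2) * (2 * (z - h) + 2 * exp (- 2 * (z - h)))
    = 2 * z + 2 * exp (- 2 * z) + 2 * \<gamma> * h" for z
  proof -
    \<comment> \<open>The two contributions to the inverse likelihood ratio add up to
      \<open>2 * E\<close>: this is the martingale property.\<close>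
    have E: "(1 / 2 + \<gamma> / 2) * (2 * (E * ((1 - \<gamma>) / (1 + \<gamma>)))) = E * (1 - \<gamma>)"
      "(1 / 2 - \<gamma> / 2) * (2 * (E * ((1 + \<gamma>) / (1 - \<gamma>)))) = E * (1 + \<gamma>)" for E
      using assms(1,2) by (simp_all add: divide_simps)
    show ?thesis
      unfolding m1 m2 distrib_left[of "1 / 2 + \<gamma> / 2"] distrib_left[of "1 / 2 - \<gamma> / 2"] E
      by (simp add: algebra_simps)
  qed
  have "yes_prob \<gamma> (x i) * \<psi> (x i) (v i + h) + (1 - yes_prob \<gamma> (x i)) * \<psi> (x i) (v i - h)
      = \<psi> (x i) (v i) + 2 * \<gamma> * h"
  proof (cases "x i")
    case True
    have "yes_prob \<gamma> (x i) = 1 / 2 + \<gamma> / 2" "1 - yes_prob \<gamma> (x i) = 1 / 2 - \<gamma> / 2"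
      using True by (simp_all add: yes_prob_def)
    then show ?thesis
      using core[of "v i"] True by (simp only: \<psi>_def Let_def if_True)
  next
    case False
    have "yes_prob \<gamma> (x i) = 1 / 2 - \<gamma> / 2" "1 - yes_prob \<gamma> (x i) = 1 / 2 + \<gamma> / 2"
      using False by (simp_all add: yes_prob_def)
    \<comment> \<open>For a false bit the two answers swap roles, so \<open>core\<close> is applied
      to \<open>- v i\<close>.\<close>
    then have "yes_prob \<gamma> (x i) * \<psi> (x i) (v i + h) + (1 - yes_prob \<gamma> (x i)) * \<psi> (x i) (v i - h)
        = (1 / 2 + \<gamma> / 2) * \<psi> (x i) (v i - h) + (1 / 2 - \<gamma> / 2) * \<psi> (x i) (v i + h)"
      by (simp only: add.commute)
    moreover have "- (v i - h) = - v i + h" "- (v i + h) = - v i - h"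
      by simp_all
    ultimately show ?thesis
      using core[of "- v i"] False by (simp only: \<psi>_def Let_def if_False)
  qed
  moreover have "p * (a + R) + (1 - p) * (b + R) = (p * a + (1 - p) * b) + R" for p a b :: real
    by (simp add: algebra_simps)
  moreover have "likelihood_potential n x v = \<psi> (x i) (v i) + R"
    using upd[of "v i"] by simp
  ultimately show ?thesis
    unfolding upd by simp
qed

text \<open>Every comparison adds the same drift in expectation. Equality can fail only because
  branches may have different lengths. The affine form is the one in which the potential enters the
  Markov-type bound on the success probability.\<close>

lemma leaf_expectation_likelihood_potential:
  assumes "0 < \<gamma>" "\<gamma> < 1" "valid_dtree n T" "0 \<le> s"
  shows "leaf_expectation \<gamma> x (\<lambda>v _. a + s * likelihood_potential n x v) T v
    \<le> a + s * (likelihood_potential n x v + 2 * \<gamma> * half_log_odds \<gamma> * real (comparisons T))"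
  using assms(3)
proof (induction T arbitrary: v)
  case (Output y)
  then show ?case by simp
next
  case (Compare i l r)
  define d where "d = 2 * \<gamma> * half_log_odds \<gamma>"
  define m where "m = real (max (comparisons l) (comparisons r))"
  define p where "p = yes_prob \<gamma> (x i)"
  define L where "L = likelihood_potential n x (v(i := v i + half_log_odds \<gamma>))"
  define R where "R = likelihood_potential n x (v(i := v i - half_log_odds \<gamma>))"
  have p: "0 \<le> p" "0 \<le> 1 - p"
    using yes_prob_bounds[OF assms(1,2)] by (auto simp: p_def)
  have "0 \<le> half_log_odds \<gamma>"
    using assms(1,2) by (simp add: half_log_odds_def)
  then have d: "0 \<le> d" using assms(1) by (simp add: d_def)
  have step: "p * L + (1 - p) * R = likelihood_potential n x v + d"
    using likelihood_potential_step[OF assms(1,2), of i n x v] Compare.prems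
    by (simp add: p_def L_def R_def d_def)
  have "leaf_expectation \<gamma> x (\<lambda>v _. a + s * likelihood_potential n x v) (Compare i l r) v
      \<le> p * (a + s * (L + d * real (comparisons l))) + (1 - p) * (a + s * (R + d * real (comparisons r)))"
    unfolding leaf_expectation.simps p_def[symmetric] L_def R_def d_def
    using Compare.prems by (intro add_mono mult_left_mono p Compare.IH) auto
  \<comment> \<open>The shallower subtree is padded to depth \<open>m\<close>, which is harmless
    because the drift \<open>d\<close> is nonnegative.\<close>
  also have "\<dots> \<le> p * (a + s * (L + d * m)) + (1 - p) * (a + s * (R + d * m))"
    using p d \<open>0 \<le> s\<close> by (intro add_mono mult_left_mono order_refl) (auto simp: m_def)
  also have "\<dots> = a + s * ((p * L + (1 - p) * R) + d * m)"
    by (simp add: algebra_simps)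
  also have "\<dots> = a + s * (likelihood_potential n x v + d * real (comparisons (Compare i l r)))"
    unfolding step m_def by (simp add: algebra_simps)
  finally show ?case
    by (simp add: d_def)
qed

section \<open>Lower bound\<close>

text \<open>At a leaf where at least half the bits have \<open>\<bar>v i\<bar> \<le> B\<close>,
  anti-concentration bounds the posterior success by \<open>\<epsilon> n K\<close>. At any other
  leaf the potential is at least \<open>n * B\<close>. Its expectation is at most its initial value
  \<open>2 * n\<close> plus the total drift, which makes such leaves rare.\<close>

lemma average_success_le:
  fixes t B \<gamma> :: real
  defines "\<epsilon> n K \<equiv> (2 * t + 1) / sqrt (2 * real K + 1) + 4 ^ K * exp (- (real n * exp (- 2 * B) / 4))"
  assumes "0 < \<gamma>" "\<gamma> < 1" "valid_dtree n T" "0 \<le> t" "0 < B" "0 < n"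
  shows "(\<Sum>A\<in>Pow {..<n}. measure_pmf.prob (run \<gamma> (\<lambda>i. i \<in> A) T)
            {y. \<bar>y - real (num_less n (\<lambda>i. i \<in> A))\<bar> \<le> t})
    \<le> 2 ^ n * (\<epsilon> n K + (2 * real n + 2 * \<gamma> * half_log_odds \<gamma> * real (comparisons T)) / (real n * B))"
proof -
  let ?P = "Pow {..<n}"
  define G where "G A v y = (indicator {z. \<bar>y - z\<bar> \<le> t} (real (card A)) :: real)"
    for A :: "nat set" and v :: "nat \<Rightarrow> real" and y :: real
  \<comment> \<open>Markov's inequality in pointwise form: the scaled potential reaches 1 when more
    than half the bits exceed \<open>B\<close>, so no event has to be conditioned on.\<close>
  define H where "H A v y = \<epsilon> n K + 1 / (real n * B) * likelihood_potential n (\<lambda>i. i \<in> A) v"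
    for A :: "nat set" and v :: "nat \<Rightarrow> real" and y :: real
  have \<epsilon>: "0 \<le> \<epsilon> n K"
    using \<open>0 \<le> t\<close> by (simp add: \<epsilon>_def)
  have w: "0 \<le> input_weight n v A" for v A
    unfolding bit_weight_def by (intro prod_nonneg) auto
  have pot: "0 \<le> likelihood_potential n x v" for x v
    by (rule order_trans[OF _ sum_abs_le_likelihood_potential]) (auto intro: sum_nonneg)
  have leaf: "(\<Sum>A\<in>?P. input_weight n v A * G A v y) \<le> (\<Sum>A\<in>?P. input_weight n v A * H A v y)" for v y
  proof (cases "real n / 2 \<le> real (card {i \<in> {..<n}. \<bar>v i\<bar> \<le> B})")
    case True
    have "(\<Sum>A\<in>?P. input_weight n v A * G A v y)
      \<le> ((2 * t + 1) / sqrt (2 * real K + 1)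
          + 4 ^ K * exp (- (real (card {i \<in> {..<n}. \<bar>v i\<bar> \<le> B}) * exp (- 2 * B) / 2)))
        * (\<Sum>A\<in>?P. input_weight n v A)"
      unfolding G_def using \<open>0 \<le> t\<close> by (intro exp_weight_concentration) auto
    also have "\<dots> \<le> \<epsilon> n K * (\<Sum>A\<in>?P. input_weight n v A)"
    proof (intro mult_right_mono sum_nonneg w)
      have "real n / 2 * exp (- 2 * B) \<le> real (card {i \<in> {..<n}. \<bar>v i\<bar> \<le> B}) * exp (- 2 * B)"
        by (intro mult_right_mono True) simp
      then show "(2 * t + 1) / sqrt (2 * real K + 1)
          + 4 ^ K * exp (- (real (card {i \<in> {..<n}. \<bar>v i\<bar> \<le> B}) * exp (- 2 * B) / 2)) \<le> \<epsilon> n K"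
        unfolding \<epsilon>_def by (intro add_left_mono mult_left_mono) auto
    qed
    also have "\<dots> \<le> (\<Sum>A\<in>?P. input_weight n v A * H A v y)"
      unfolding sum_distrib_left mult.commute[of "\<epsilon> n K"]
      using \<open>0 < B\<close> by (intro sum_mono mult_left_mono w) (auto simp: H_def pot)
    finally show ?thesis .
  next
    case False
    define S where "S = {i \<in> {..<n}. B < \<bar>v i\<bar>}"
    have "n = card ({i \<in> {..<n}. \<bar>v i\<bar> \<le> B} \<union> S)"
      by (subst card_lessThan[of n, symmetric], rule arg_cong[of _ _ card]) (auto simp: S_def)
    also have "\<dots> = card {i \<in> {..<n}. \<bar>v i\<bar> \<le> B} + card S"
      by (rule card_Un_disjoint) (auto simp: S_def)
    finally have "real n / 2 \<le> real (card S)"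
      using False by linarith
    then have "real n / 2 * (2 * B) \<le> real (card S) * (2 * B)"
      using \<open>0 < B\<close> by (intro mult_right_mono) auto
    also have "\<dots> = (\<Sum>i\<in>S. 2 * B)" by simp
    also have "\<dots> \<le> (\<Sum>i\<in>S. 2 * \<bar>v i\<bar>)"
      by (intro sum_mono) (auto simp: S_def)
    also have "\<dots> \<le> (\<Sum>i<n. 2 * \<bar>v i\<bar>)"
      by (intro sum_mono2) (auto simp: S_def)
    finally have "real n * B \<le> likelihood_potential n x v" for x
      using sum_abs_le_likelihood_potential[of v n x] by simp
    then have "1 \<le> H A v y" for A
      using \<epsilon> \<open>0 < B\<close> \<open>0 < n\<close> by (simp add: H_def add_increasing)
    moreover have "G A v y \<le> 1" for A
      by (simp add: G_def indicator_def)
    ultimately show ?thesis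
      by (intro sum_mono mult_left_mono w) (meson order_trans)
  qed
  \<comment> \<open>In the zero state every input has weight 1, so the prior is uniform up to the
    factor \<open>2 ^ n\<close>.\<close>
  have "(\<Sum>A\<in>?P. measure_pmf.prob (run \<gamma> (\<lambda>i. i \<in> A) T) {y. \<bar>y - real (num_less n (\<lambda>i. i \<in> A))\<bar> \<le> t})
      = (\<Sum>A\<in>?P. input_weight n (\<lambda>_. 0) A * leaf_expectation \<gamma> (\<lambda>i. i \<in> A) (G A) T (\<lambda>_. 0))"
  proof (intro sum.cong refl)
    fix A assume "A \<in> ?P"
    then have "num_less n (\<lambda>i. i \<in> A) = card A"
      unfolding num_less_def by (intro arg_cong[of _ _ card]) auto
    moreover have G: "G A = (\<lambda>_ y. indicator {y. \<bar>y - real (card A)\<bar> \<le> t} y)"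
      by (auto simp: G_def indicator_def fun_eq_iff)
    ultimately show "measure_pmf.prob (run \<gamma> (\<lambda>i. i \<in> A) T) {y. \<bar>y - real (num_less n (\<lambda>i. i \<in> A))\<bar> \<le> t}
      = input_weight n (\<lambda>_. 0) A * leaf_expectation \<gamma> (\<lambda>i. i \<in> A) (G A) T (\<lambda>_. 0)"
      unfolding prob_run_eq_leaf_expectation[OF assms(2,3), where v = "\<lambda>_. 0"]
      by (simp add: G bit_weight_def)
  qed
  also have "\<dots> \<le> (\<Sum>A\<in>?P. input_weight n (\<lambda>_. 0) A * leaf_expectation \<gamma> (\<lambda>i. i \<in> A) (H A) T (\<lambda>_. 0))"
    by (intro sum_leaf_expectation_mono assms leaf)
  also have "\<dots> \<le> (\<Sum>A\<in>?P. \<epsilon> n K + (2 * real n + 2 * \<gamma> * half_log_odds \<gamma> * real (comparisons T)) / (real n * B))"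
  proof (intro sum_mono)
    fix A
    have "leaf_expectation \<gamma> (\<lambda>i. i \<in> A) (H A) T (\<lambda>_. 0)
      \<le> \<epsilon> n K + 1 / (real n * B) * (likelihood_potential n (\<lambda>i. i \<in> A) (\<lambda>_. 0)
          + 2 * \<gamma> * half_log_odds \<gamma> * real (comparisons T))"
      unfolding H_def[abs_def] using \<open>0 < B\<close> by (intro leaf_expectation_likelihood_potential assms) simp
    also have "likelihood_potential n (\<lambda>i. i \<in> A) (\<lambda>_. 0) = 2 * real n"
    proof -
      have "(if b then 0 else - 0) = (0 :: real)" for b by simp
      then show ?thesis by (simp only: likelihood_potential_def Let_def) simp
    qed
    finally show "input_weight n (\<lambda>_. 0) A * leaf_expectation \<gamma> (\<lambda>i. i \<in> A) (H A) T (\<lambda>_. 0)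
      \<le> \<epsilon> n K + (2 * real n + 2 * \<gamma> * half_log_odds \<gamma> * real (comparisons T)) / (real n * B)"
      by (simp add: bit_weight_def)
  qed
  also have "\<dots> = 2 ^ n * (\<epsilon> n K + (2 * real n + 2 * \<gamma> * half_log_odds \<gamma> * real (comparisons T)) / (real n * B))"
    by (simp add: card_Pow)
  finally show ?thesis .
qed

text \<open>The averaging direction of Yao's principle: worst-case success is at most success on a
  uniform input, and exchanging sum and integral reduces this to almost every single tree.\<close>

lemma success_probability_le_average:
  assumes alg: "randomized_algorithm n \<gamma> M" and approx: "approximates_rank n \<gamma> t p M"
    and bound: "AE T in M. (\<Sum>A\<in>Pow {..<n}. measure_pmf.prob (run \<gamma> (\<lambda>i. i \<in> A) T)
            {y. \<bar>y - real (num_less n (\<lambda>i. i \<in> A))\<bar> \<le> t}) \<le> 2 ^ n * s"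
  shows "p \<le> s"
proof -
  interpret prob_space M
    using alg by (simp add: randomized_algorithm_def)
  define S where "S A = {y. \<bar>y - real (num_less n (\<lambda>i. i \<in> A))\<bar> \<le> t}" for A
  have "S A = cball (real (num_less n (\<lambda>i. i \<in> A))) t" for A
    by (auto simp: S_def dist_real_def)
  then have "S A \<in> sets borel" for A by simp
  then have int: "integrable M (\<lambda>T. measure_pmf.prob (run \<gamma> (\<lambda>i. i \<in> A) T) (S A))" for A
    using alg by (intro integrable_const_bound[where B = 1]) (auto simp: randomized_algorithm_def)
  have "2 ^ n * p = (\<Sum>A\<in>Pow {..<n}. p)"
    by (simp add: card_Pow)
  also have "\<dots> \<le> (\<Sum>A\<in>Pow {..<n}. output_prob \<gamma> (\<lambda>i. i \<in> A) M (S A))"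
    using approx by (intro sum_mono) (simp add: approximates_rank_def S_def)
  also have "\<dots> = (\<integral>T. (\<Sum>A\<in>Pow {..<n}. measure_pmf.prob (run \<gamma> (\<lambda>i. i \<in> A) T) (S A)) \<partial>M)"
    unfolding output_prob_def by (rule Bochner_Integration.integral_sum[symmetric]) (rule int)
  also have "\<dots> \<le> (\<integral>T. 2 ^ n * s \<partial>M)"
    using bound by (intro integral_mono_AE) (auto simp: S_def[symmetric] intro: int)
  also have "\<dots> = 2 ^ n * s"
    by (simp add: prob_space)
  finally show ?thesis by simp
qed

text \<open>With \<open>B = ln n / 20\<close>, \<open>exp (- 2 * B)\<close> is
  \<open>n powr (- 1 / 10)\<close>. The exponent \<open>4 / 5\<close> of \<open>K\<close> lies above
  \<open>3 / 4\<close>, so that \<open>sqrt K\<close> dominates \<open>n powr (3 / 8)\<close>, and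
  below \<open>9 / 10\<close>, so that the exponential beats \<open>4 ^ K\<close>.\<close>

lemma eventually_error_terms_le:
  "\<forall>\<^sub>F n in sequentially.
     (2 * (real n powr (3 / 8) / 40) + 1) / sqrt (2 * real (nat \<lfloor>real n powr (4 / 5)\<rfloor>) + 1)
     + 4 ^ nat \<lfloor>real n powr (4 / 5)\<rfloor> * exp (- (real n * exp (- 2 * (ln (real n) / 20)) / 4))
     + 40 / ln (real n) \<le> 1 / 2"
proof -
  \<comment> \<open>The floor is replaced by its lower bound under the root and its upper bound in
    the exponent, leaving an elementary function of \<open>n\<close>.\<close>
  have "((\<lambda>n. (2 * (real n powr (3 / 8) / 40) + 1) / sqrt (2 * (real n powr (4 / 5) - 1) + 1)
     + exp (ln 4 * real n powr (4 / 5)) * exp (- (real n * exp (- 2 * (ln (real n) / 20)) / 4))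
     + 40 / ln (real n)) \<longlongrightarrow> 0) sequentially"
    by real_asymp
  then have "\<forall>\<^sub>F n in sequentially.
     (2 * (real n powr (3 / 8) / 40) + 1) / sqrt (2 * (real n powr (4 / 5) - 1) + 1)
     + exp (ln 4 * real n powr (4 / 5)) * exp (- (real n * exp (- 2 * (ln (real n) / 20)) / 4))
     + 40 / ln (real n) < 1 / 2"
    by (rule order_tendstoD) simp
  then show ?thesis
    using eventually_ge_at_top[of 1]
  proof eventually_elim
    case (elim n)
    define r where "r = real n powr (4 / 5)"
    define K where "K = nat \<lfloor>r\<rfloor>"
    have r: "1 \<le> r"
      using elim(2) by (simp add: r_def ge_one_powr_ge_zero)
    have K: "r - 1 \<le> real K" "real K \<le> r"
      using r by (auto simp: K_def)
    have "(4::real) ^ K = exp (ln 4 * real K)"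
      by (simp add: exp_of_nat2_mult)
    then have "(4::real) ^ K \<le> exp (ln 4 * r)"
      using K by simp
    then have 1: "4 ^ K * exp (- (real n * exp (- 2 * (ln (real n) / 20)) / 4))
      \<le> exp (ln 4 * r) * exp (- (real n * exp (- 2 * (ln (real n) / 20)) / 4))"
      by (rule mult_right_mono) simp
    have 2: "(2 * (real n powr (3 / 8) / 40) + 1) / sqrt (2 * real K + 1)
      \<le> (2 * (real n powr (3 / 8) / 40) + 1) / sqrt (2 * (r - 1) + 1)"
      using K r by (intro divide_left_mono mult_pos_pos) auto
    show ?case
      using elim(1) 1 2 unfolding r_def[symmetric] K_def[symmetric] by linarith
  qed
qed

theorem theorem11:
  fixes \<gamma>0 :: real
  assumes "\<gamma>0 < 1"
  shows "\<exists>c>0. \<exists>N. \<forall>n\<ge>N. \<forall>\<gamma> :: real. \<forall>A :: dtree measure. \<forall>q :: nat.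
           0 < \<gamma> \<longrightarrow> \<gamma> \<le> \<gamma>0 \<longrightarrow>
           randomized_algorithm n \<gamma> A \<longrightarrow>
           approximates_rank n \<gamma> (real n powr (3 / 8) / 40) (2 / 3) A \<longrightarrow>
           query_complexity_le A q \<longrightarrow>
           real q \<ge> c * (real n * ln (real n) / \<gamma>\<^sup>2)"
proof -
  \<comment> \<open>Chosen so that the drift of the potential is at most
    \<open>2 / (1 - \<gamma>0) * c * n * ln n = n * B / 10\<close> for
    \<open>B = ln n / 20\<close>.\<close>
  define c where "c = (1 - \<gamma>0) / 400"
  have "0 < c" using assms by (simp add: c_def)
  from eventually_error_terms_le obtain N0 where N0:
    "\<And>n. N0 \<le> n \<Longrightarrow>
     (2 * (real n powr (3 / 8) / 40) + 1) / sqrt (2 * real (nat \<lfloor>real n powr (4 / 5)\<rfloor>) + 1)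
     + 4 ^ nat \<lfloor>real n powr (4 / 5)\<rfloor> * exp (- (real n * exp (- 2 * (ln (real n) / 20)) / 4))
     + 40 / ln (real n) \<le> 1 / 2"
    unfolding eventually_sequentially by blast
  have "c * (real n * ln (real n) / \<gamma>\<^sup>2) \<le> real q"
    if n: "max N0 2 \<le> n" and \<gamma>: "0 < \<gamma>" "\<gamma> \<le> \<gamma>0"
      and alg: "randomized_algorithm n \<gamma> A"
      and approx: "approximates_rank n \<gamma> (real n powr (3 / 8) / 40) (2 / 3) A"
      and q: "query_complexity_le A q"
    for n \<gamma> A q
  proof (rule ccontr)
    assume "\<not> c * (real n * ln (real n) / \<gamma>\<^sup>2) \<le> real q"
    then have small: "real q * \<gamma>\<^sup>2 < c * (real n * ln (real n))"
      using \<gamma> by (simp add: field_simps)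
    have \<gamma>1: "\<gamma> < 1" using \<gamma> assms by simp
    define B where "B = ln (real n) / 20"
    define K where "K = nat \<lfloor>real n powr (4 / 5)\<rfloor>"
    define h where "h = half_log_odds \<gamma>"
    have ln: "0 < ln (real n)" and B: "0 < B" and n0: "0 < n"
      using n by (auto simp: B_def)
    have h: "0 \<le> h"
      using \<gamma> \<gamma>1 by (simp add: h_def half_log_odds_def)
    have "2 * h \<le> 2 * \<gamma> / (1 - \<gamma>)"
      unfolding h_def by (rule half_log_odds_le[OF \<gamma>(1) \<gamma>1])
    also have "\<dots> \<le> 2 * \<gamma> / (1 - \<gamma>0)"
      using \<gamma> assms by (intro divide_left_mono mult_pos_pos) auto
    finally have "\<gamma> * (2 * h) \<le> \<gamma> * (2 * \<gamma> / (1 - \<gamma>0))"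
      using \<gamma> by (intro mult_left_mono) auto
    then have "2 * \<gamma> * h * real q \<le> 2 / (1 - \<gamma>0) * (real q * \<gamma>\<^sup>2)"
      using mult_right_mono[of "\<gamma> * (2 * h)" "\<gamma> * (2 * \<gamma> / (1 - \<gamma>0))" "real q"]
      by (simp add: power2_eq_square mult_ac)
    also have "\<dots> \<le> 2 / (1 - \<gamma>0) * (c * (real n * ln (real n)))"
      using small assms by (intro mult_left_mono) auto
    also have "\<dots> = real n * B / 10"
      using assms by (simp add: c_def B_def)
    finally have drift: "2 * \<gamma> * h * real q \<le> real n * B / 10" .
    define s where "s = (2 * (real n powr (3 / 8) / 40) + 1) / sqrt (2 * real K + 1)
      + 4 ^ K * exp (- (real n * exp (- 2 * B) / 4)) + (2 * real n + 2 * \<gamma> * h * real q) / (real n * B)"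
    have "2 * real n / (real n * B) = 40 / ln (real n)"
      using n0 by (simp add: B_def)
    moreover have "2 * \<gamma> * h * real q / (real n * B) \<le> 1 / 10"
      using drift n0 B by (simp add: divide_le_eq)
    \<comment> \<open>The drift costs at most \<open>1 / 10\<close> and all other terms together at
      most \<open>1 / 2\<close>; the total \<open>3 / 5\<close> is below the required
      \<open>2 / 3\<close>.\<close>
    ultimately have "s \<le> 1 / 2 + 1 / 10"
      using N0[of n] n unfolding s_def K_def[symmetric] B_def[symmetric] add_divide_distrib by simp
    moreover have "2 / 3 \<le> s"
    proof (rule success_probability_le_average[OF alg approx])
      have "AE T in A. valid_dtree n T \<and> comparisons T \<le> q"
        using alg q by (auto simp: randomized_algorithm_def query_complexity_le_def)
      then show "AE T in A. (\<Sum>A\<in>Pow {..<n}. measure_pmf.prob (run \<gamma> (\<lambda>i. i \<in> A) T)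
            {y. \<bar>y - real (num_less n (\<lambda>i. i \<in> A))\<bar> \<le> real n powr (3 / 8) / 40}) \<le> 2 ^ n * s"
      proof eventually_elim
        case (elim T)
        have "2 * \<gamma> * h * real (comparisons T) \<le> 2 * \<gamma> * h * real q"
          using elim \<gamma> h by (intro mult_left_mono) auto
        then have "(2 * real n + 2 * \<gamma> * h * real (comparisons T)) / (real n * B)
          \<le> (2 * real n + 2 * \<gamma> * h * real q) / (real n * B)"
          using B by (intro divide_right_mono) auto
        then show ?case
          using elim B n0
          by (intro order_trans[OF average_success_le[OF \<gamma>(1) \<gamma>1, of n T _ B K]])
            (auto simp: s_def h_def)
      qed
    qed
    ultimately show False by simp
  qed
  then show ?thesis
    using \<open>0 < c\<close> by blast
qed

end
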